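(* Fix $L\in\mathbb{N}_+$ (with $L+2\le N$) and let $0\le n\le L$. Then for every $\eta\in\Omega_N$ $$\mathbf{b}_{n,L}(\eta)\big(\mathbf{e}_{0,1}(\eta)-\mathbf{e}_{1,0}(\eta)\big)=-\nabla\mathbf{H}_{n,L}(\eta),$$ where $\mathbf{H}_{n,L}=\mathbf{h}_{n,L}+\mathbf{g}_{n,L}$ with $$\mathbf{h}_{n,L}(\eta)=\frac{1}{L+1}\,\mathbf{1}\Big\{\langle\eta\rangle_L\ge\tfrac{n+1}{L+1}\Big\},$$ $$\mathbf{g}_{n,L}(\eta)=\frac{1}{L+1}\sum_{j=1}^{L}\sum_{i=1}^{j}\mathbf{b}_{n,L}^j(\tau^{j-i}\eta)\big(\mathbf{e}_{0,1}(\tau^{j-i}\eta)-\mathbf{e}_{1,0}(\tau^{j-i}\eta)\big).$$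
   Context: $N\in\mathbb{N}_+$ is fixed, $\mathbb{T}_N=\mathbb{Z}/N\mathbb{Z}$ is the one-dimensional discrete torus and $\Omega_N=\{0,1\}^{\mathbb{T}_N}$ is the set of configurations; $\eta(x)\in\{0,1\}$ is the occupation value of $\eta$ at $x$. The shift $\tau:\Omega_N\to\Omega_N$ is $(\tau\eta)(x)=\eta(x+1)$, $\tau^i$ is its $i$-th iterate, and for $f:\Omega_N\to\mathbb{R}$ one sets $\tau f(\eta)=f(\tau\eta)$ and $\nabla f=\tau f-f$, i.e. $\nabla f(\eta)=f(\tau\eta)-f(\eta)$. The exclusion constraints are $\mathbf{e}_{0,1}(\eta)=\eta(0)(1-\eta(1))$ and $\mathbf{e}_{1,0}(\eta)=\eta(1)(1-\eta(0))$. Integer intervals $\llbracket a,b\rrbracket=\{a,\dots,b\}$ are viewed in $\mathbb{T}_N$. For $L\in\mathbb{N}_+$ with $L+2\le N$ and $0\le j\le L$ put $W_j^L=\llbracket -j,-j+L+1\rrbracket\setminus\{0,1\}$ (a set of $L$ sites) and let $m_j^L(\eta)=\sum_{x\in W_j^L}\eta(x)$ be the number of particles in $W_j^L$. For $0\le n\le L$, $$\mathbf{b}_{n,L}=\frac{1}{L+1}\sum_{j=0}^{L}\mathbf{b}_{n,L}^j,\qquad \mathbf{b}_{n,L}^j(\eta)=\mathbf{1}\{m_j^L(\eta)=n\}.$$ Finally $\langle\eta\rangle_L=\frac{1}{L+1}\sum_{z\in\llbracket 0,L\rrbracket}\eta(z)$ is the density in the box $\llbracket 0,L\rrbracket$.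 *)

theory Defs
  imports Complex_Main "Berlekamp_Zassenhaus.Finite_Field"
begin

text \<open>
  The torus \<open>\<int>/N\<int>\<close> is the ring \<^typ>\<open>'n mod_ring\<close> with \<open>N = CARD('n)\<close>. The class
  \<^class>\<open>nontriv\<close>, which gives access to the ring unit, amounts to \<open>N \<ge> 2\<close>; this is implied
  by \<open>L + 2 \<le> N\<close>.
\<close>

type_synonym 'n config = "'n mod_ring \<Rightarrow> nat"

definition configs :: "'n::nontriv config set" ("\<Omega>") where
  "\<Omega> = {\<eta>. \<forall>x. \<eta> x \<in> {0, 1}}"

definition shift :: "'n::nontriv config \<Rightarrow> 'n config" ("\<tau>") where
  "\<tau> \<eta> = (\<lambda>x. \<eta> (x + 1))"

definition grad :: "('n::nontriv config \<Rightarrow> real) \<Rightarrow> 'n config \<Rightarrow> real" ("\<nabla>") where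
  "\<nabla> f = (\<lambda>\<eta>. f (\<tau> \<eta>) - f \<eta>)"

definition e01 :: "'n::nontriv config \<Rightarrow> real" where
  "e01 \<eta> = real (\<eta> 0) * (1 - real (\<eta> 1))"

definition e10 :: "'n::nontriv config \<Rightarrow> real" where
  "e10 \<eta> = real (\<eta> 1) * (1 - real (\<eta> 0))"

text \<open>Integer intervals are viewed in the torus through their images, so sums over them run over
  sites; for the intervals used below \<open>L + 2 \<le> N\<close> makes this image injective.\<close>

definition torus_interval :: "int \<Rightarrow> int \<Rightarrow> 'n::nontriv mod_ring set" where
  "torus_interval a b = of_int ` {a..b}"

definition window :: "nat \<Rightarrow> nat \<Rightarrow> 'n::nontriv mod_ring set" where
  "window L j = torus_interval (- int j) (- int j + int L + 1) - {0, 1}"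

definition window_mass :: "nat \<Rightarrow> nat \<Rightarrow> 'n::nontriv config \<Rightarrow> nat" where
  "window_mass L j \<eta> = (\<Sum>x\<in>window L j. \<eta> x)"

definition b_win :: "nat \<Rightarrow> nat \<Rightarrow> nat \<Rightarrow> 'n::nontriv config \<Rightarrow> real" where
  "b_win n L j \<eta> = of_bool (window_mass L j \<eta> = n)"

definition b_avg :: "nat \<Rightarrow> nat \<Rightarrow> 'n::nontriv config \<Rightarrow> real" where
  "b_avg n L \<eta> = 1 / (real L + 1) * (\<Sum>j = 0..L. b_win n L j \<eta>)"

definition density :: "nat \<Rightarrow> 'n::nontriv config \<Rightarrow> real" where
  "density L \<eta> = 1 / (real L + 1) * (\<Sum>z\<in>torus_interval 0 (int L). real (\<eta> z))"

definition h_fun :: "nat \<Rightarrow> nat \<Rightarrow> 'n::nontriv config \<Rightarrow> real" where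
  "h_fun n L \<eta> = 1 / (real L + 1) * of_bool (density L \<eta> \<ge> (real n + 1) / (real L + 1))"

definition g_fun :: "nat \<Rightarrow> nat \<Rightarrow> 'n::nontriv config \<Rightarrow> real" where
  "g_fun n L \<eta> = 1 / (real L + 1) *
     (\<Sum>j = 1..L. \<Sum>i = 1..j.
        b_win n L j ((\<tau> ^^ (j - i)) \<eta>) * (e01 ((\<tau> ^^ (j - i)) \<eta>) - e10 ((\<tau> ^^ (j - i)) \<eta>)))"

definition H_fun :: "nat \<Rightarrow> nat \<Rightarrow> 'n::nontriv config \<Rightarrow> real" where
  "H_fun n L \<eta> = h_fun n L \<eta> + g_fun n L \<eta>"

end

theory Submission
  imports Defs
begin

text \<open>
  For configurations \<open>e01 - e10 = \<eta>(0) - \<eta>(1)\<close>, and the inner sums of \<open>g\<close> telescope under the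
  gradient, leaving the current through the bond \<open>(0, 1)\<close> with window \<open>j\<close> minus the one through
  the bond \<open>(j, j + 1)\<close>. Every shifted window is the box \<open>[0, L + 1]\<close> with the two endpoints of
  the bond removed. A bond carries a nonzero current only if exactly one of its endpoints is
  occupied, so there the window constraint says that the box contains \<open>n + 1\<close> particles, a
  condition independent of \<open>j\<close>. Hence the shifted currents also telescope, to the difference
  between the two ends of the box, which is what the gradient of \<open>h\<close> sees.
\<close>

lemma shift_pow: "(\<tau> ^^ k) \<eta> x = \<eta> (x + of_nat k)"
  by (induction k arbitrary: x) (simp_all add: shift_def ac_simps)

lemma e01_minus_e10: "e01 \<eta> - e10 \<eta> = real (\<eta> 0) - real (\<eta> 1)"
  by (simp add: e01_def e10_def algebra_simps)

text \<open>Integers with the same image differ by a multiple of \<open>CARD('n)\<close>, and the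
  interval is too short for a nonzero one.\<close>

lemma inj_on_of_int_mod_ring:
  assumes "b - a < int CARD('n)"
  shows "inj_on (of_int :: int \<Rightarrow> 'n::nontriv mod_ring) {a..b}"
proof (rule inj_onI)
  fix x y assume xy: "x \<in> {a..b}" "y \<in> {a..b}"
    and eq: "(of_int x :: 'n mod_ring) = of_int y"
  have "int CARD('n) dvd x - y"
    using eq by (simp add: of_int_eq_iff_cong_CHAR cong_iff_dvd_diff)
  moreover have "\<bar>x - y\<bar> < int CARD('n)"
    using xy assms by auto
  ultimately show "x = y"
    using dvd_imp_le_int[of "x - y" "int CARD('n)"] by fastforce
qed

lemma sum_torus_interval:
  assumes "b - a < int CARD('n)"
  shows "(\<Sum>x\<in>torus_interval a b. f x) = (\<Sum>k=a..b. f (of_int k :: 'n::nontriv mod_ring))"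
  unfolding torus_interval_def
  by (simp add: sum.reindex[OF inj_on_of_int_mod_ring[OF assms]])

text \<open>Serves the windows, with \<open>Suc L\<close> for \<open>L\<close>, and the density box,
  with \<open>j = 0\<close>.\<close>

lemma sum_torus_interval_shift:
  assumes "L < CARD('n)"
  shows "(\<Sum>x\<in>torus_interval (- int j) (- int j + int L). f (x + of_nat j))
    = (\<Sum>k\<le>L. f (of_nat k :: 'n::nontriv mod_ring))"
proof -
  have "(\<Sum>x\<in>torus_interval (- int j) (- int j + int L). f (x + of_nat j))
      = (\<Sum>k = - int j..- int j + int L. f (of_int k + of_nat j :: 'n mod_ring))"
    using assms by (subst sum_torus_interval) simp_all
  also have "\<dots> = (\<Sum>k\<le>L. f (of_nat k))"
    by (rule sum.reindex_bij_witness[of _ "\<lambda>k. int k - int j" "\<lambda>k. nat (k + int j)"])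
      (auto simp: nat_le_iff)
  finally show ?thesis .
qed

lemma window_mass_shift_pow:
  fixes \<eta> :: "'n::nontriv config"
  assumes "L + 2 \<le> CARD('n)" "j \<le> L"
  shows "window_mass L j ((\<tau> ^^ j) \<eta>) + \<eta> (of_nat j) + \<eta> (of_nat (Suc j))
    = (\<Sum>k\<le>Suc L. \<eta> (of_nat k))"
proof -
  define I :: "'n mod_ring set" where "I = torus_interval (- int j) (- int j + int (Suc L))"
  have w: "window L j = I - {0, 1}"
    by (simp add: window_def I_def add_ac)
  have fin: "finite I"
    by (simp add: I_def torus_interval_def)
  \<comment> \<open>The site 1 lies in the interval because \<open>j \<le> L\<close> gives 1 \<le> L
    + 1 - j.\<close>
  have "of_int 0 \<in> I" "of_int 1 \<in> I"
    unfolding I_def torus_interval_def using assms by (auto intro!: imageI simp del: of_int_0 of_int_1)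
  then have "{0, 1} \<subseteq> I" by simp
  then have "(\<Sum>x\<in>I. \<eta> (x + of_nat j))
      = (\<Sum>x\<in>I - {0, 1}. \<eta> (x + of_nat j)) + (\<Sum>x\<in>{0, 1}. \<eta> (x + of_nat j))"
    using fin by (rule sum.subset_diff)
  moreover have "(\<Sum>x\<in>I. \<eta> (x + of_nat j)) = (\<Sum>k\<le>Suc L. \<eta> (of_nat k))"
    unfolding I_def using assms by (intro sum_torus_interval_shift) simp
  ultimately show ?thesis
    by (simp add: window_mass_def w shift_pow)
qed

lemma density_ge_iff:
  fixes \<eta> :: "'n::nontriv config"
  assumes "L < CARD('n)"
  shows "density L \<eta> \<ge> (real n + 1) / (real L + 1) \<longleftrightarrow> n < (\<Sum>k\<le>L. \<eta> (of_nat k))"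
proof -
  have "(\<Sum>z\<in>torus_interval 0 (int L). real (\<eta> z)) = real (\<Sum>k\<le>L. \<eta> (of_nat k))"
    using sum_torus_interval_shift[OF assms, of "\<lambda>x. real (\<eta> x)" 0] by simp
  then show ?thesis
    by (simp add: density_def divide_le_cancel del: of_nat_sum) linarith
qed

definition current :: "nat \<Rightarrow> nat \<Rightarrow> nat \<Rightarrow> 'n::nontriv config \<Rightarrow> real" where
  "current n L j \<eta> = b_win n L j \<eta> * (e01 \<eta> - e10 \<eta>)"

text \<open>Reversing \<open>i\<close> to \<open>j - i\<close> makes the shifts increase; the empty
  term \<open>j = 0\<close> is added to match the range of \<open>b_avg\<close>.\<close>

lemma g_fun_eq:
  "g_fun n L \<eta> = (\<Sum>j\<le>L. \<Sum>i<j. current n L j ((\<tau> ^^ i) \<eta>)) / (real L + 1)"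
proof -
  have "(\<Sum>i = 1..j. current n L j ((\<tau> ^^ (j - i)) \<eta>)) = (\<Sum>i<j. current n L j ((\<tau> ^^ i) \<eta>))" for j
    by (rule sum.reindex_bij_witness[of _ "\<lambda>i. j - i" "\<lambda>i. j - i"]) auto
  then show ?thesis
    by (simp add: g_fun_def atMost_atLeast0 sum.atLeast_Suc_atMost flip: current_def)
qed

lemma grad_g_fun:
  "\<nabla> (g_fun n L) \<eta>
    = (\<Sum>j\<le>L. current n L j ((\<tau> ^^ j) \<eta>) - current n L j \<eta>) / (real L + 1)"
proof -
  have "(\<Sum>i<j. current n L j ((\<tau> ^^ i) (\<tau> \<eta>))) - (\<Sum>i<j. current n L j ((\<tau> ^^ i) \<eta>))
      = current n L j ((\<tau> ^^ j) \<eta>) - current n L j \<eta>" for j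
    using sum_lessThan_telescope[of "\<lambda>i. current n L j ((\<tau> ^^ i) \<eta>)" j]
    by (simp add: sum_subtractf funpow_swap1)
  then show ?thesis
    by (simp add: grad_def g_fun_eq flip: diff_divide_distrib sum_subtractf)
qed

lemma current_shift_pow:
  fixes \<eta> :: "'n::nontriv config"
  assumes "L + 2 \<le> CARD('n)" "\<eta> \<in> \<Omega>" "j \<le> L"
  shows "current n L j ((\<tau> ^^ j) \<eta>) = of_bool ((\<Sum>k\<le>Suc L. \<eta> (of_nat k)) = Suc n)
    * (real (\<eta> (of_nat j)) - real (\<eta> (of_nat (Suc j))))"
proof -
  have "\<eta> (of_nat j) \<in> {0, 1}" "\<eta> (of_nat (Suc j)) \<in> {0, 1}"
    using assms(2) unfolding configs_def by blast+
  moreover have "e01 ((\<tau> ^^ j) \<eta>) - e10 ((\<tau> ^^ j) \<eta>)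
      = real (\<eta> (of_nat j)) - real (\<eta> (of_nat (Suc j)))"
    by (simp add: e01_minus_e10 shift_pow)
  \<comment> \<open>Equal endpoint values annul both sides; unequal ones add exactly 1 to the window
    mass.\<close>
  ultimately show ?thesis
    using window_mass_shift_pow[OF assms(1,3), of \<eta>]
    by (auto simp: current_def b_win_def simp del: sum.atMost_Suc of_nat_Suc)
qed

lemma grad_h_fun:
  fixes \<eta> :: "'n::nontriv config"
  assumes "L + 2 \<le> CARD('n)" "\<eta> \<in> \<Omega>"
  shows "\<nabla> (h_fun n L) \<eta> = - (\<Sum>j\<le>L. current n L j ((\<tau> ^^ j) \<eta>)) / (real L + 1)"
proof -
  define A where "A = (\<Sum>k\<le>Suc L. \<eta> (of_nat k))"
  define z where "z = \<eta> (of_nat (Suc L))"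
  have ends: "\<eta> 0 \<in> {0, 1}" "z \<in> {0, 1}"
    using assms(2) unfolding configs_def z_def by blast+
  have "A = (\<Sum>k\<le>L. \<eta> (of_nat k)) + z"
    by (simp add: A_def z_def)
  moreover have "A = \<eta> 0 + (\<Sum>k\<le>L. \<tau> \<eta> (of_nat k))"
    unfolding A_def by (subst sum.atMost_Suc_shift) (simp add: shift_def add.commute)
  moreover have "\<nabla> (h_fun n L) \<eta> = (of_bool (n < (\<Sum>k\<le>L. \<tau> \<eta> (of_nat k)))
      - of_bool (n < (\<Sum>k\<le>L. \<eta> (of_nat k)))) / (real L + 1)"
    using assms(1) by (simp add: grad_def h_fun_def density_ge_iff diff_divide_distrib)
  moreover have "(\<Sum>j\<le>L. current n L j ((\<tau> ^^ j) \<eta>))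
      = of_bool (A = Suc n) * (\<Sum>j\<le>L. real (\<eta> (of_nat j)) - real (\<eta> (of_nat (Suc j))))"
    using assms by (simp add: current_shift_pow A_def sum_distrib_left del: sum.atMost_Suc of_nat_Suc)
  moreover have "(\<Sum>j\<le>L. real (\<eta> (of_nat j)) - real (\<eta> (of_nat (Suc j))))
      = real (\<eta> 0) - real z"
    unfolding z_def by (subst sum_telescope) simp
  \<comment> \<open>The box sums after and before the shift are \<open>A - \<eta> 0\<close> and
    \<open>A - z\<close>. If \<open>\<eta> 0 = z\<close>, both sides vanish; otherwise the
    thresholds are \<open>A - 1\<close> and \<open>A\<close>, and exceeding \<open>n\<close>
    distinguishes them only for \<open>A = Suc n\<close>.\<close>
  ultimately show ?thesis
    using ends by auto
qed

theorem proposition2p7: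
  fixes \<eta> :: "'n::nontriv config" and L n :: nat
  assumes "L \<ge> 1" and "L + 2 \<le> CARD('n)" and "n \<le> L" and "\<eta> \<in> \<Omega>"
  shows "b_avg n L \<eta> * (e01 \<eta> - e10 \<eta>) = - \<nabla> (H_fun n L) \<eta>"
proof -
  have "b_avg n L \<eta> * (e01 \<eta> - e10 \<eta>) = (\<Sum>j\<le>L. current n L j \<eta>) / (real L + 1)"
    by (simp add: b_avg_def current_def sum_distrib_right atMost_atLeast0)
  moreover have "\<nabla> (H_fun n L) \<eta> = \<nabla> (h_fun n L) \<eta> + \<nabla> (g_fun n L) \<eta>"
    by (simp add: grad_def H_fun_def)
  \<comment> \<open>The gradient of \<open>h_fun\<close> cancels the shifted currents in that of
    \<open>g_fun\<close>, leaving minus the unshifted ones.\<close>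
  ultimately show ?thesis
    using grad_h_fun[OF assms(2,4), of n]
    by (simp add: grad_g_fun sum_subtractf diff_divide_distrib)
qed

end
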